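(* Let $K$ be a field of characteristic zero, let $n\ge 1$, let $q(z)\in K[z]=K[z_1,\dots,z_n]$, and let $\mathcal{C}=\{\partial_i-\partial_i(q(z))\mid 1\le i\le n\}$. Then $\operatorname{Im}\mathcal{C}$ is a finite co-dimensional $K$-subspace of $K[z]$, i.e. the $K$-vector space $K[z]/\operatorname{Im}\mathcal{C}$ is finite dimensional.
   Context: $\partial_i:=\partial/\partial z_i$, each $\partial_i-\partial_i(q)$ acts on $K[z]$ by $f\mapsto\partial_i f-f\,\partial_i q$, and $\operatorname{Im}\mathcal{C}:=\sum_{i=1}^n(\partial_i-\partial_i(q))(K[z])$. *)

theory Defs
  imports
    "HOL-Library.Poly_Mapping"
    "HOL-Algebra.AbelCoset"
    "Jordan_Normal_Form.VS_Connect"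
begin

text \<open>
  Polynomials over \<open>'k\<close> in variables indexed by the finite type \<open>'n\<close> are finitely supported
  maps from exponent vectors to coefficients; the ring structure is the convolution product of
  \<^theory>\<open>HOL-Library.Poly_Mapping\<close>. The number of variables is \<open>CARD('n) \<ge> 1\<close>.
\<close>

type_synonym ('n, 'k) mvpoly = "('n \<Rightarrow>\<^sub>0 nat) \<Rightarrow>\<^sub>0 'k"

text \<open>
  The derivative of \<open>c * z^m\<close> with respect to \<open>z_i\<close> is \<open>m_i * c * z^(m - e_i)\<close>. If \<open>m_i = 0\<close>, the
  exponent subtraction is truncated, but the coefficient vanishes.
\<close>

definition partial_deriv :: "'n \<Rightarrow> ('n, 'k::field) mvpoly \<Rightarrow> ('n, 'k) mvpoly" where
  "partial_deriv i f =
     (\<Sum>m\<in>Poly_Mapping.keys f.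
        Poly_Mapping.single (m - Poly_Mapping.single i 1)
          (of_nat (Poly_Mapping.lookup m i) * Poly_Mapping.lookup f m))"

lemma lookup_partial_deriv:
  "Poly_Mapping.lookup (partial_deriv i f) m =
     of_nat (Poly_Mapping.lookup m i + 1) * Poly_Mapping.lookup f (m + Poly_Mapping.single i 1)"
proof -
  let ?e = "Poly_Mapping.single i (1::nat)"
  have shift: "l = m + ?e" if "l - ?e = m" "Poly_Mapping.lookup l i \<noteq> 0" for l
    using that by (intro poly_mapping_eqI) (auto simp: lookup_add lookup_minus lookup_single when_def)
  have "Poly_Mapping.lookup (partial_deriv i f) m =
      (\<Sum>l\<in>Poly_Mapping.keys f.
         if l = m + ?e then of_nat (Poly_Mapping.lookup l i) * Poly_Mapping.lookup f l else 0)"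
    unfolding partial_deriv_def lookup_sum
  proof (rule sum.cong[OF refl])
    fix l
    show "Poly_Mapping.lookup (Poly_Mapping.single (l - ?e)
              (of_nat (Poly_Mapping.lookup l i) * Poly_Mapping.lookup f l)) m =
          (if l = m + ?e then of_nat (Poly_Mapping.lookup l i) * Poly_Mapping.lookup f l else 0)"
    proof (cases "Poly_Mapping.lookup l i = 0")
      case True
      then have "l \<noteq> m + ?e" by (auto simp: lookup_add)
      with True show ?thesis by simp
    next
      case False
      then have "l - ?e = m \<longleftrightarrow> l = m + ?e" using shift by auto
      then show ?thesis by (simp add: lookup_single when_def)
    qed
  qed
  also have "\<dots> = of_nat (Poly_Mapping.lookup m i + 1) * Poly_Mapping.lookup f (m + ?e)"
    by (auto simp: sum.delta lookup_add in_keys_iff)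
  finally show ?thesis .
qed

definition twisted_deriv ::
    "('n, 'k::field) mvpoly \<Rightarrow> 'n \<Rightarrow> ('n, 'k) mvpoly \<Rightarrow> ('n, 'k) mvpoly" where
  "twisted_deriv q i f = partial_deriv i f - f * partial_deriv i q"

definition Im_C :: "('n::finite, 'k::field) mvpoly \<Rightarrow> ('n, 'k) mvpoly set" where
  "Im_C q = {\<Sum>i\<in>UNIV. twisted_deriv q i (f i) | f. True}"

text \<open>\<open>K[z]\<close> as a vector space; scalars act through constant polynomials.\<close>

definition mvpoly_space :: "('k::field, ('n, 'k) mvpoly) module" where
  "mvpoly_space =
     \<lparr>carrier = UNIV, mult = (*), one = 1, zero = 0, add = (+),
      smult = (\<lambda>c f. Poly_Mapping.single 0 c * f)\<rparr>"

text \<open>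
  The quotient of a vector space \<open>V\<close> by a subspace \<open>W\<close>, carried by the cosets of \<open>W\<close>. The scalar
  multiple of a coset \<open>A\<close> is the coset of \<open>c x\<close> for any \<open>x \<in> A\<close> (the union over all
  representatives avoids a choice). The multiplicative fields of the record play no role in a
  module.
\<close>

definition quotient_space :: "('k, 'v, 'm) module_scheme \<Rightarrow> 'v set \<Rightarrow> ('k, 'v set) module" where
  "quotient_space V W =
     \<lparr>carrier = a_rcosets\<^bsub>V\<^esub> W, mult = undefined, one = undefined, zero = W,
      add = set_add V, smult = (\<lambda>c A. \<Union>x\<in>A. W +>\<^bsub>V\<^esub> (c \<odot>\<^bsub>V\<^esub> x))\<rparr>"

lemma subspace_imp_abelian_subgroup:
  assumes "subspace K W V"
  shows "abelian_subgroup W V"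
proof -
  interpret V: vectorspace K V using assms by (simp add: VectorSpace.subspace_def)
  have sm: "submodule K W V" using assms by (simp add: VectorSpace.subspace_def)
  have neg: "\<ominus>\<^bsub>V\<^esub> x \<in> W" if "x \<in> W" for x
    using submodule.smult_closed[OF sm, of "\<ominus>\<^bsub>K\<^esub> \<one>\<^bsub>K\<^esub>" x] submodule.subset[OF sm] that
    by (simp add: V.smult_minus_1 subset_iff)
  have "subgroup W (add_monoid V)"
    using submodule.subset[OF sm] submodule.zero_closed[OF sm] submodule.m_closed[OF sm] neg
    by (intro V.add.subgroupI) (auto simp: a_inv_def)
  then show ?thesis
    by (intro abelian_subgroupI3 additive_subgroup.intro V.abelian_group_axioms)
qed

lemma quotient_space_smult_coset:
  assumes W: "subspace K W V" and c: "c \<in> carrier K" and x: "x \<in> carrier V"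
  shows "c \<odot>\<^bsub>quotient_space V W\<^esub> (W +>\<^bsub>V\<^esub> x) = W +>\<^bsub>V\<^esub> (c \<odot>\<^bsub>V\<^esub> x)"
proof -
  interpret V: vectorspace K V using W by (simp add: VectorSpace.subspace_def)
  have sm: "submodule K W V" using W by (simp add: VectorSpace.subspace_def)
  interpret W: abelian_subgroup W V using W by (rule subspace_imp_abelian_subgroup)
  have "W +>\<^bsub>V\<^esub> (c \<odot>\<^bsub>V\<^esub> y) = W +>\<^bsub>V\<^esub> (c \<odot>\<^bsub>V\<^esub> x)" if y: "y \<in> W +>\<^bsub>V\<^esub> x" for y
  proof -
    have yV: "y \<in> carrier V" using W.a_elemrcos_carrier x y by blast
    obtain w where w: "w \<in> W" "y = w \<oplus>\<^bsub>V\<^esub> x" using y by (auto simp: a_r_coset_def')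
    then have "c \<odot>\<^bsub>V\<^esub> y = c \<odot>\<^bsub>V\<^esub> w \<oplus>\<^bsub>V\<^esub> c \<odot>\<^bsub>V\<^esub> x" using c x by (simp add: V.smult_r_distr)
    moreover have "c \<odot>\<^bsub>V\<^esub> w \<in> W" using submodule.smult_closed[OF sm] c w by blast
    ultimately have "c \<odot>\<^bsub>V\<^esub> y \<in> W +>\<^bsub>V\<^esub> (c \<odot>\<^bsub>V\<^esub> x)" by (auto simp: a_r_coset_def')
    then show ?thesis using W.a_repr_independence' c x by (metis V.smult_closed)
  qed
  then have "(\<Union>y\<in>W +>\<^bsub>V\<^esub> x. W +>\<^bsub>V\<^esub> (c \<odot>\<^bsub>V\<^esub> y)) =
      (\<Union>y\<in>W +>\<^bsub>V\<^esub> x. W +>\<^bsub>V\<^esub> (c \<odot>\<^bsub>V\<^esub> x))"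
    by (rule SUP_cong[OF refl])
  also have "\<dots> = W +>\<^bsub>V\<^esub> (c \<odot>\<^bsub>V\<^esub> x)"
    using W.a_rcos_self[OF x] by blast
  finally show ?thesis by (simp add: quotient_space_def)
qed

lemma vectorspace_quotient_space:
  assumes W: "subspace K W V"
  shows "vectorspace K (quotient_space V W)"
proof -
  interpret V: vectorspace K V using W by (simp add: VectorSpace.subspace_def)
  interpret W: abelian_subgroup W V using W by (rule subspace_imp_abelian_subgroup)
  let ?Q = "quotient_space V W"
  have carr: "carrier ?Q = (\<lambda>x. W +>\<^bsub>V\<^esub> x) ` carrier V"
    by (auto simp: quotient_space_def A_RCOSETS_def')
  have zero: "\<zero>\<^bsub>?Q\<^esub> = W +>\<^bsub>V\<^esub> \<zero>\<^bsub>V\<^esub>"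
    by (simp add: quotient_space_def W.a_rcos_const)
  have add: "(W +>\<^bsub>V\<^esub> x) \<oplus>\<^bsub>?Q\<^esub> (W +>\<^bsub>V\<^esub> y) = W +>\<^bsub>V\<^esub> (x \<oplus>\<^bsub>V\<^esub> y)"
    if "x \<in> carrier V" "y \<in> carrier V" for x y
    using that by (simp add: quotient_space_def W.a_rcos_sum)
  note smult = quotient_space_smult_coset[OF W]
  have "abelian_group ?Q"
  proof (rule abelian_groupI)
    fix A assume "A \<in> carrier ?Q"
    then obtain x where x: "x \<in> carrier V" "A = W +>\<^bsub>V\<^esub> x" by (auto simp: carr)
    have "(W +>\<^bsub>V\<^esub> (\<ominus>\<^bsub>V\<^esub> x)) \<oplus>\<^bsub>?Q\<^esub> A = \<zero>\<^bsub>?Q\<^esub>" using x by (simp add: add zero V.l_neg)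
    then show "\<exists>B\<in>carrier ?Q. B \<oplus>\<^bsub>?Q\<^esub> A = \<zero>\<^bsub>?Q\<^esub>" using x by (auto simp: carr)
  next
    fix A B C assume "A \<in> carrier ?Q" "B \<in> carrier ?Q" "C \<in> carrier ?Q"
    then show "A \<oplus>\<^bsub>?Q\<^esub> B \<oplus>\<^bsub>?Q\<^esub> C = A \<oplus>\<^bsub>?Q\<^esub> (B \<oplus>\<^bsub>?Q\<^esub> C)"
      by (auto simp: carr add V.a_assoc)
  next
    fix A B assume "A \<in> carrier ?Q" "B \<in> carrier ?Q"
    then obtain x y where "x \<in> carrier V" "y \<in> carrier V" "A = W +>\<^bsub>V\<^esub> x" "B = W +>\<^bsub>V\<^esub> y"
      by (auto simp: carr)
    then show "A \<oplus>\<^bsub>?Q\<^esub> B = B \<oplus>\<^bsub>?Q\<^esub> A"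
      using V.a_comm[of x y] by (simp add: add)
  qed (auto simp: carr add zero)
  then have "Module.module K ?Q"
    by (rule moduleI[OF V.is_cring])
       (auto simp: carr add smult V.smult_l_distr V.smult_r_distr V.smult_assoc1)
  then show ?thesis
    by (rule vectorspace.intro[OF _ V.field_axioms])
qed

end

theory Submission
  imports Defs "HOL-Library.Cardinality"
begin

text \<open>
  Write \<open>D\<^sub>i = \<partial>\<^sub>i - \<partial>\<^sub>i q\<close>, let \<open>D\<^sup>\<alpha>\<close> be a composition of these operators in which each \<open>D\<^sub>i\<close>
  occurs \<open>\<alpha>\<^sub>i\<close> times, and let \<open>n\<close> be the number of variables. The product rule
  \<open>D\<^sub>i (g f) = g D\<^sub>i f + (\<partial>\<^sub>i g) f\<close> is an integration by parts modulo \<open>Im C\<close>, and iterated it gives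
  \<open>g D\<^sup>\<alpha> f \<equiv> (-1)\<^bsup>|\<alpha>|\<^esup> (\<partial>\<^sup>\<alpha> g) f\<close> (lemma \<open>iterated_integration_by_parts\<close>).

  Let \<open>f\<^sub>1, \<dots>, f\<^sub>N\<close> be linearly independent modulo \<open>Im C\<close>. Then all the polynomials \<open>D\<^sup>\<alpha> f\<^sub>k\<close> are
  linearly independent (lemma \<open>independent_mod_twisted_deriv\<close>). Indeed, suppose that
  \<open>\<Sum> u(\<alpha>,k) D\<^sup>\<alpha> f\<^sub>k = 0\<close>, and that \<open>u(\<alpha>,\<cdot>) = 0\<close> whenever \<open>|\<alpha>| < |\<beta>|\<close>. Multiplication by \<open>z\<^sup>\<beta>\<close> gives
  \<open>\<Sum> \<plusminus> u(\<alpha>,k) (\<partial>\<^sup>\<alpha> z\<^sup>\<beta>) f\<^sub>k \<equiv> 0\<close>. Here \<open>\<partial>\<^sup>\<alpha> z\<^sup>\<beta> = 0\<close> unless \<open>\<alpha> \<le> \<beta>\<close>, so only \<open>\<alpha> = \<beta>\<close> contributes, and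
  \<open>\<partial>\<^sup>\<beta> z\<^sup>\<beta> = \<beta>!\<close> is a nonzero constant in characteristic zero. Hence \<open>u(\<beta>,\<cdot>) = 0\<close>.

  On the other hand, \<open>D\<^sub>i\<close> raises the degree in each variable by at most a constant \<open>d\<close>. If the
  \<open>f\<^sub>k\<close> have degree at most \<open>s\<close> in each variable, then the \<open>N (s+1)\<^sup>n\<close> independent polynomials
  \<open>D\<^sup>\<alpha> f\<^sub>k\<close> with all \<open>\<alpha>\<^sub>i \<le> s\<close> have degree at most \<open>s + d n s\<close> in each variable. So
  \<open>N (s+1)\<^sup>n \<le> (s + d n s + 1)\<^sup>n \<le> (s+1)\<^sup>n (1 + d n)\<^sup>n\<close>, that is \<open>N \<le> (1 + d n)\<^sup>n\<close> (lemma
  \<open>card_independent_mod_Im_C_le\<close>). This bounds the dimension of the quotient.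
\<close>

section \<open>Polynomials as a vector space, and the product rule\<close>

text \<open>Scalar multiplication of polynomials, through constant polynomials.\<close>

definition pscale :: "'k::field \<Rightarrow> ('n, 'k) mvpoly \<Rightarrow> ('n, 'k) mvpoly" where
  "pscale c f = Poly_Mapping.single 0 c * f"

interpretation mvp: vector_space "pscale :: 'k::field \<Rightarrow> ('n, 'k) mvpoly \<Rightarrow> ('n, 'k) mvpoly"
  by unfold_locales
     (simp_all add: pscale_def algebra_simps single_add mult_single mult.assoc[symmetric])

lemma partial_deriv_add: "partial_deriv i (f + g) = partial_deriv i f + partial_deriv i g"
  by (rule poly_mapping_eqI) (simp only: lookup_partial_deriv lookup_add distrib_left)

lemma partial_deriv_zero [simp]: "partial_deriv i 0 = 0"
  by (rule poly_mapping_eqI) (simp add: lookup_partial_deriv)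

lemma partial_deriv_single:
  "partial_deriv i (Poly_Mapping.single m a) =
     Poly_Mapping.single (m - Poly_Mapping.single i 1) (of_nat (Poly_Mapping.lookup m i) * a)"
  by (cases "a = 0") (simp_all add: partial_deriv_def)

lemma sum_monomials:
  fixes f :: "'a \<Rightarrow>\<^sub>0 'b::comm_monoid_add"
  shows "f = (\<Sum>m\<in>Poly_Mapping.keys f. Poly_Mapping.single m (Poly_Mapping.lookup f m))"
  by (rule poly_mapping_eqI)
     (simp add: lookup_sum lookup_single when_def sum.delta' in_keys_iff)

lemma mvpoly_induct [case_names zero monomial_add]:
  fixes f :: "'a \<Rightarrow>\<^sub>0 'b::comm_monoid_add"
  assumes "P 0" and "\<And>m a f. P f \<Longrightarrow> P (Poly_Mapping.single m a + f)"
  shows "P f"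
proof -
  have "P (\<Sum>m\<in>A. Poly_Mapping.single m (Poly_Mapping.lookup f m))" for A
    by (induction A rule: infinite_finite_induct) (simp_all add: assms)
  then show ?thesis by (subst sum_monomials)
qed

lemma partial_deriv_mult:
  "partial_deriv i (f * g) = partial_deriv i f * g + f * partial_deriv i g"
proof -
  let ?e = "Poly_Mapping.single i (1::nat)"
  have shift: "k - ?e + l = k + l - ?e" if "Poly_Mapping.lookup k i > 0" for k l :: "'a \<Rightarrow>\<^sub>0 nat"
    using that by (intro poly_mapping_eqI) (auto simp: lookup_add lookup_minus lookup_single when_def)
  have single: "partial_deriv i (Poly_Mapping.single k a * Poly_Mapping.single l b) =
      partial_deriv i (Poly_Mapping.single k a) * Poly_Mapping.single l b +
      Poly_Mapping.single k a * partial_deriv i (Poly_Mapping.single l b)" for k l and a b :: 'b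
  proof -
    have 1: "Poly_Mapping.single (k - ?e + l) (of_nat (Poly_Mapping.lookup k i) * a * b) =
             Poly_Mapping.single (k + l - ?e) (of_nat (Poly_Mapping.lookup k i) * a * b)"
      using shift[of k l] by (cases "Poly_Mapping.lookup k i = 0") auto
    have 2: "Poly_Mapping.single (k + (l - ?e)) (a * (of_nat (Poly_Mapping.lookup l i) * b)) =
             Poly_Mapping.single (k + l - ?e) (a * (of_nat (Poly_Mapping.lookup l i) * b))"
      using shift[of l k] by (cases "Poly_Mapping.lookup l i = 0") (auto simp: add.commute)
    show ?thesis
      unfolding mult_single partial_deriv_single 1 2 single_add[symmetric]
      by (simp add: lookup_add algebra_simps)
  qed
  have "partial_deriv i (Poly_Mapping.single k a * g) =
      partial_deriv i (Poly_Mapping.single k a) * g + Poly_Mapping.single k a * partial_deriv i g"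
    for k a
    by (induction g rule: mvpoly_induct)
       (simp_all add: distrib_left partial_deriv_add single)
  then show ?thesis
    by (induction f rule: mvpoly_induct)
       (simp_all add: distrib_right partial_deriv_add)
qed

lemma partial_deriv_pscale: "partial_deriv i (pscale c f) = pscale c (partial_deriv i f)"
  by (simp add: pscale_def partial_deriv_mult partial_deriv_single)

section \<open>Integration by parts modulo the image\<close>

lemma twisted_deriv_add: "twisted_deriv q i (f + g) = twisted_deriv q i f + twisted_deriv q i g"
  by (simp add: twisted_deriv_def partial_deriv_add algebra_simps)

lemma twisted_deriv_pscale: "twisted_deriv q i (pscale c f) = pscale c (twisted_deriv q i f)"
  by (simp add: twisted_deriv_def partial_deriv_pscale mvp.scale_right_diff_distrib)
     (simp add: pscale_def mult.assoc)

lemma twisted_deriv_zero [simp]: "twisted_deriv q i 0 = 0"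
  by (simp add: twisted_deriv_def)

lemma subspace_Im_C: "mvp.subspace (Im_C (q :: ('n::finite, 'k::field) mvpoly))"
proof (rule mvp.subspaceI)
  show "0 \<in> Im_C q"
    unfolding Im_C_def by (intro CollectI exI[of _ "\<lambda>_. 0"]) simp
next
  fix x y assume "x \<in> Im_C q" "y \<in> Im_C q"
  then obtain f g where "x = (\<Sum>i\<in>UNIV. twisted_deriv q i (f i))"
      "y = (\<Sum>i\<in>UNIV. twisted_deriv q i (g i))"
    by (auto simp: Im_C_def)
  then have "x + y = (\<Sum>i\<in>UNIV. twisted_deriv q i (f i + g i))"
    by (simp add: twisted_deriv_add sum.distrib)
  then show "x + y \<in> Im_C q" 
    unfolding Im_C_def by (intro CollectI exI[of _ "\<lambda>i. f i + g i"]) simp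
next
  fix c x assume "x \<in> Im_C q"
  then obtain f where "x = (\<Sum>i\<in>UNIV. twisted_deriv q i (f i))"
    by (auto simp: Im_C_def)
  then have "pscale c x = (\<Sum>i\<in>UNIV. twisted_deriv q i (pscale c (f i)))"
    by (simp add: twisted_deriv_pscale mvp.scale_sum_right)
  then show "pscale c x \<in> Im_C q"
    unfolding Im_C_def by (intro CollectI exI[of _ "\<lambda>i. pscale c (f i)"]) simp
qed

lemma twisted_deriv_in_Im_C: "twisted_deriv q i f \<in> Im_C (q :: ('n::finite, 'k::field) mvpoly)"
proof -
  have "twisted_deriv q i f = (\<Sum>j\<in>UNIV. twisted_deriv q j (if j = i then f else 0))"
    by (subst sum.remove[of _ i]) auto
  then show ?thesis
    unfolding Im_C_def by (intro CollectI exI[of _ "\<lambda>j. if j = i then f else 0"]) simp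
qed

lemma integration_by_parts:
  "g * twisted_deriv q i f + partial_deriv i g * f \<in> Im_C (q :: ('n::finite, 'k::field) mvpoly)"
proof -
  have "g * twisted_deriv q i f + partial_deriv i g * f = twisted_deriv q i (g * f)"
    by (simp add: twisted_deriv_def partial_deriv_mult algebra_simps)
  then show ?thesis by (simp add: twisted_deriv_in_Im_C)
qed

text \<open>
  A list \<open>w\<close> of variables encodes a composition of operators; it stands for \<open>D\<^sup>\<alpha>\<close> when each \<open>i\<close>
  occurs \<open>\<alpha>\<^sub>i\<close> times in \<open>w\<close>. Moving the operators to the other factor reverses their order, whence
  \<^const>\<open>foldr\<close> on one side and \<^const>\<open>fold\<close> on the other.
\<close>

lemma iterated_integration_by_parts:
  fixes q :: "('n::finite, 'k::field) mvpoly"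
  shows "g * foldr (twisted_deriv q) w f - (-1) ^ length w * (fold partial_deriv w g * f) \<in> Im_C q"
proof (induction w arbitrary: g)
  case Nil
  show ?case using mvp.subspace_0[OF subspace_Im_C] by simp
next
  case (Cons i w)
  let ?h = "foldr (twisted_deriv q) w f"
  have "(g * twisted_deriv q i ?h + partial_deriv i g * ?h) -
      (partial_deriv i g * ?h - (-1) ^ length w * (fold partial_deriv w (partial_deriv i g) * f))
      \<in> Im_C q"
    by (intro mvp.subspace_diff[OF subspace_Im_C] integration_by_parts Cons.IH)
  then show ?case by (simp add: algebra_simps)
qed

lemma fold_partial_deriv_zero [simp]: "fold partial_deriv w 0 = 0"
  by (induction w) simp_all

lemma fold_partial_deriv_monomial_eq_0:
  assumes "Poly_Mapping.lookup b j < count_list w j"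
  shows "fold partial_deriv w (Poly_Mapping.single b a) = 0"
  using assms
proof (induction w arbitrary: b a)
  case (Cons i w)
  show ?case
  proof (cases "Poly_Mapping.lookup b i = 0")
    case True
    then show ?thesis by (simp add: partial_deriv_single)
  next
    case False
    with Cons.prems have "Poly_Mapping.lookup (b - Poly_Mapping.single i 1) j < count_list w j"
      by (auto simp: lookup_minus lookup_single when_def split: if_splits)
    from Cons.IH[OF this] show ?thesis by (simp add: partial_deriv_single)
  qed
qed simp

text \<open>The constant is \<open>\<beta>! a\<close> for the exponent \<open>\<beta>\<close>; it is nonzero because of characteristic zero.\<close>

lemma fold_partial_deriv_monomial_const:
  fixes a :: "'k::field_char_0"
  assumes "\<And>j. count_list w j = Poly_Mapping.lookup b j" and "a \<noteq> 0"
  shows "\<exists>c. c \<noteq> 0 \<and> fold partial_deriv w (Poly_Mapping.single b a) = Poly_Mapping.single 0 c"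
  using assms
proof (induction w arbitrary: b a)
  case Nil
  then have "b = 0" by (intro poly_mapping_eqI) simp
  with Nil show ?case by auto
next
  case (Cons i w)
  have "Poly_Mapping.lookup b i \<noteq> 0" using Cons.prems(1)[of i] by simp
  moreover have "count_list w j = Poly_Mapping.lookup (b - Poly_Mapping.single i 1) j" for j
    using Cons.prems(1)[of j] by (auto simp: lookup_minus lookup_single when_def split: if_splits)
  ultimately show ?case
    using Cons.IH[of "b - Poly_Mapping.single i 1" "of_nat (Poly_Mapping.lookup b i) * a"]
      Cons.prems(2)
    by (simp add: partial_deriv_single)
qed

lemma ex_word_of_exponent:
  fixes m :: "'n::finite \<Rightarrow>\<^sub>0 nat"
  shows "\<exists>w. \<forall>i. count_list w i = Poly_Mapping.lookup m i"
proof -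
  obtain w where "mset w = (\<Sum>i\<in>UNIV. replicate_mset (Poly_Mapping.lookup m i) i)"
    using ex_mset by blast
  then have "count_list w i = Poly_Mapping.lookup m i" for i
    by (simp add: count_mset[symmetric] count_sum)
  then show ?thesis by blast
qed

section \<open>Exponents bounded in each variable\<close>

text \<open>
  The exponent vectors with all entries at most \<open>s\<close>. Polynomials with exponents in \<open>box s\<close> are those
  of degree at most \<open>s\<close> in each variable separately.
\<close>

definition box :: "nat \<Rightarrow> ('n \<Rightarrow>\<^sub>0 nat) set" where
  "box s = {m. \<forall>i. Poly_Mapping.lookup m i \<le> s}"

lemma box_mono: "s \<le> t \<Longrightarrow> box s \<subseteq> box t"
  by (auto simp: box_def intro: order_trans)

lemma finite_card_box:
  "finite (box s :: ('n::finite \<Rightarrow>\<^sub>0 nat) set)"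
  "card (box s :: ('n \<Rightarrow>\<^sub>0 nat) set) = (s + 1) ^ CARD('n)"
proof -
  have "bij_betw Poly_Mapping.lookup (box s :: ('n \<Rightarrow>\<^sub>0 nat) set) (UNIV \<rightarrow>\<^sub>E {..s})"
    by (rule bij_betwI[where g = Abs_poly_mapping])
       (auto simp: box_def PiE_def extensional_def lookup_Abs_poly_mapping lookup_inverse)
  moreover have "finite (UNIV \<rightarrow>\<^sub>E {..s} :: ('n \<Rightarrow> nat) set)" by (intro finite_PiE) auto
  moreover have "card (UNIV \<rightarrow>\<^sub>E {..s} :: ('n \<Rightarrow> nat) set) = (s + 1) ^ CARD('n)"
    by (simp add: card_PiE)
  ultimately show "finite (box s :: ('n \<Rightarrow>\<^sub>0 nat) set)"
    "card (box s :: ('n \<Rightarrow>\<^sub>0 nat) set) = (s + 1) ^ CARD('n)"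
    by (simp_all add: bij_betw_finite bij_betw_same_card)
qed

lemma finite_subset_box:
  assumes "finite (A :: ('n::finite \<Rightarrow>\<^sub>0 nat) set)"
  shows "\<exists>s. A \<subseteq> box s"
proof -
  let ?E = "(\<lambda>(m, i). Poly_Mapping.lookup m i) ` (A \<times> UNIV)"
  have "finite ?E" using assms by (intro finite_imageI finite_cartesian_product) auto
  then have "Poly_Mapping.lookup m i \<le> Max ?E" if "m \<in> A" for m i
    using that by (intro Max_ge) auto
  then show ?thesis by (auto simp: box_def)
qed

lemma keys_subset_box_imp_span:
  assumes "Poly_Mapping.keys f \<subseteq> A"
  shows "f \<in> mvp.span ((\<lambda>m. Poly_Mapping.single m 1) ` A)"
proof -
  have "Poly_Mapping.single m a \<in> mvp.span ((\<lambda>m. Poly_Mapping.single m 1) ` A)" if "m \<in> A" for m a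
  proof -
    have "Poly_Mapping.single m a = pscale a (Poly_Mapping.single m 1)"
      by (simp add: pscale_def mult_single)
    then show ?thesis using that by (auto intro: mvp.span_scale mvp.span_base)
  qed
  then show ?thesis
    using assms by (subst sum_monomials) (auto intro: mvp.span_sum)
qed

lemma keys_partial_deriv_box:
  assumes "Poly_Mapping.keys f \<subseteq> box s"
  shows "Poly_Mapping.keys (partial_deriv i f) \<subseteq> box s"
proof
  fix m assume "m \<in> Poly_Mapping.keys (partial_deriv i f)"
  then have "m + Poly_Mapping.single i 1 \<in> Poly_Mapping.keys f"
    by (auto simp: in_keys_iff lookup_partial_deriv)
  then have "m + Poly_Mapping.single i 1 \<in> box s" using assms by blast
  then have "Poly_Mapping.lookup m j + Poly_Mapping.lookup (Poly_Mapping.single i 1) j \<le> s" for j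
    by (simp add: box_def lookup_add)
  then have "Poly_Mapping.lookup m j \<le> s" for j using add_leD1 by blast
  then show "m \<in> box s" by (simp add: box_def)
qed

lemma keys_mult_box:
  assumes "Poly_Mapping.keys f \<subseteq> box s" "Poly_Mapping.keys g \<subseteq> box t"
  shows "Poly_Mapping.keys (f * g :: ('n, 'k::field) mvpoly) \<subseteq> box (s + t)"
proof
  fix m assume "m \<in> Poly_Mapping.keys (f * g)"
  then obtain a b where "m = a + b" "a \<in> Poly_Mapping.keys f" "b \<in> Poly_Mapping.keys g"
    using keys_mult[of f g] by blast
  then show "m \<in> box (s + t)" using assms by (auto simp: box_def lookup_add intro!: add_mono)
qed

lemma keys_twisted_deriv_box:
  assumes "Poly_Mapping.keys f \<subseteq> box s" "Poly_Mapping.keys (partial_deriv i q) \<subseteq> box d"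
  shows "Poly_Mapping.keys (twisted_deriv q i f) \<subseteq> box (s + d)"
  unfolding twisted_deriv_def
  using keys_diff[of "partial_deriv i f" "f * partial_deriv i q"]
    keys_partial_deriv_box[OF assms(1), of i] keys_mult_box[OF assms] box_mono[of s "s + d"]
  by fastforce

lemma keys_foldr_twisted_deriv_box:
  assumes "\<And>i. Poly_Mapping.keys (partial_deriv i q) \<subseteq> box d" "Poly_Mapping.keys f \<subseteq> box s"
  shows "Poly_Mapping.keys (foldr (twisted_deriv q) w f) \<subseteq> box (s + d * length w)"
proof (induction w)
  case (Cons i w)
  show ?case using keys_twisted_deriv_box[OF Cons.IH assms(1)[of i]] by (simp add: algebra_simps)
qed (simp add: assms)

section \<open>Independence modulo the image\<close>

text \<open>
  The independent vectors are given as a family, and the hypothesis \<open>indep\<close> includes that the family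
  is injective.
\<close>

lemma card_independent_family_le:
  fixes h :: "'p \<Rightarrow> ('n, 'k::field) mvpoly"
  assumes P: "finite P" and T: "finite T" and span: "h ` P \<subseteq> mvp.span T"
    and indep: "\<And>u p. (\<Sum>p\<in>P. pscale (u p) (h p)) = 0 \<Longrightarrow> p \<in> P \<Longrightarrow> u p = 0"
  shows "card P \<le> card T"
proof -
  have inj: "inj_on h P"
  proof (rule inj_onI, rule ccontr)
    fix a b assume ab: "a \<in> P" "b \<in> P" "h a = h b" "a \<noteq> b"
    let ?u = "\<lambda>p. (if p = a then 1 else 0) - (if p = b then 1 else 0) :: 'k"
    have "(\<Sum>p\<in>P. pscale (?u p) (h p)) =
        (\<Sum>p\<in>P. (if p = a then h p else 0) - (if p = b then h p else 0))"
      by (intro sum.cong) (auto simp: mvp.scale_left_diff_distrib)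
    also have "\<dots> = 0" using ab P by (simp add: sum_subtractf sum.delta)
    finally have "?u a = 0" using indep[of ?u a] ab by blast
    then show False using ab by simp
  qed
  have "mvp.independent (h ` P)"
  proof (rule mvp.independent_if_scalars_zero)
    fix u x assume "(\<Sum>x\<in>h ` P. pscale (u x) x) = 0" "x \<in> h ` P"
    then show "u x = 0" using indep[of "u \<circ> h"] by (auto simp: sum.reindex[OF inj])
  qed (use P in simp)
  then have "card (h ` P) \<le> card T" using mvp.independent_span_bound[OF T _ span] by blast
  then show ?thesis by (simp add: card_image[OF inj])
qed

text \<open>
  The finite set \<open>F\<close> is linearly independent modulo the subspace \<open>W\<close>: its elements have distinct,
  linearly independent classes in the quotient by \<open>W\<close>.
\<close>

definition independent_mod :: "('n, 'k::field) mvpoly set \<Rightarrow> ('n, 'k) mvpoly set \<Rightarrow> bool" where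
  "independent_mod W F \<longleftrightarrow>
     finite F \<and> (\<forall>u. (\<Sum>k\<in>F. pscale (u k) k) \<in> W \<longrightarrow> (\<forall>k\<in>F. u k = 0))"

lemma independent_modD:
  assumes "independent_mod W F" "(\<Sum>k\<in>F. pscale (u k) k) \<in> W" "k \<in> F"
  shows "u k = 0"
proof -
  have "\<forall>k\<in>F. u k = 0"
    using assms(1) unfolding independent_mod_def by (elim conjE allE[of _ u] impE) (rule assms(2))
  then show ?thesis using assms(3) by blast
qed

text \<open>
  Linear independence of the \<open>D\<^sup>\<alpha> k\<close>, by induction on the total degree of \<open>\<alpha>\<close>. The function
  \<open>word\<close> chooses the order in which the operators of \<open>D\<^sup>\<alpha>\<close> are composed.
\<close>

lemma independent_mod_twisted_deriv:
  fixes q :: "('n::finite, 'k::field_char_0) mvpoly"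
  assumes F: "independent_mod (Im_C q) F" and A: "finite A"
    and word: "\<And>m i. count_list (word m) i = Poly_Mapping.lookup m i"
    and rel: "(\<Sum>(m, k)\<in>A \<times> F. pscale (u (m, k)) (foldr (twisted_deriv q) (word m) k)) = 0"
    and "m \<in> A" "k \<in> F"
  shows "u (m, k) = 0"
  using \<open>m \<in> A\<close> \<open>k \<in> F\<close>
proof (induction "\<Sum>i\<in>UNIV. Poly_Mapping.lookup m i" arbitrary: m k rule: less_induct)
  case less
  let ?D = "\<lambda>w. foldr (twisted_deriv q) w"
  let ?z = "Poly_Mapping.single m (1::'k)"
  let ?c = "\<lambda>l. (-1) ^ length (word l) * fold partial_deriv (word l) ?z"
  \<comment> \<open>After multiplication by \<open>z\<^sup>m\<close>, the terms with \<open>l \<noteq> m\<close> vanish: if \<open>l \<le> m\<close> fails, then because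
      \<open>\<partial>\<^sup>l z\<^sup>m = 0\<close>, and otherwise because \<open>u (l, _) = 0\<close> by induction.\<close>
  have vanish: "pscale (u (l, k')) (?c l * k') = 0" if lk: "l \<in> A" "k' \<in> F" "l \<noteq> m" for l k'
  proof (cases "\<exists>j. Poly_Mapping.lookup m j < count_list (word l) j")
    case True
    then show ?thesis by (auto simp: fold_partial_deriv_monomial_eq_0)
  next
    case False
    then have le: "Poly_Mapping.lookup l j \<le> Poly_Mapping.lookup m j" for j
      by (auto simp: word not_less)
    obtain j where "Poly_Mapping.lookup l j \<noteq> Poly_Mapping.lookup m j"
      using lk(3) by (metis poly_mapping_eqI)
    then have "(\<Sum>i\<in>UNIV. Poly_Mapping.lookup l i) < (\<Sum>i\<in>UNIV. Poly_Mapping.lookup m i)"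
      using le by (intro sum_strict_mono_ex1) (auto simp: less_le)
    then show ?thesis using less.hyps lk by simp
  qed
  obtain c where c: "c \<noteq> 0" "fold partial_deriv (word m) ?z = Poly_Mapping.single 0 c"
    using fold_partial_deriv_monomial_const[of "word m" m "1::'k"] word by auto
  define c' where "c' = (-1) ^ length (word m) * c"
  have "c' \<noteq> 0" using c by (simp add: c'_def)
  have sgn: "(-1) ^ n * Poly_Mapping.single 0 c =
      (Poly_Mapping.single 0 ((-1) ^ n * c) :: ('n, 'k) mvpoly)" for n
    by (induction n) (simp_all add: single_uminus)
  have cm: "?c m = Poly_Mapping.single 0 c'" by (simp add: c'_def c(2) sgn)
  have "(\<Sum>(l, k')\<in>A \<times> F. pscale (u (l, k')) (?z * ?D (word l) k' - ?c l * k')) \<in> Im_C q"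
    using iterated_integration_by_parts[of ?z q]
    by (intro mvp.subspace_sum[OF subspace_Im_C])
       (auto intro!: mvp.subspace_scale[OF subspace_Im_C] simp: mult.assoc)
  also have "(\<Sum>(l, k')\<in>A \<times> F. pscale (u (l, k')) (?z * ?D (word l) k' - ?c l * k')) =
      ?z * (\<Sum>(l, k')\<in>A \<times> F. pscale (u (l, k')) (?D (word l) k')) -
      (\<Sum>(l, k')\<in>A \<times> F. pscale (u (l, k')) (?c l * k'))"
    by (simp add: sum_distrib_left mvp.scale_right_diff_distrib sum_subtractf split_beta)
       (simp add: pscale_def algebra_simps)
  also have "\<dots> = - (\<Sum>(l, k')\<in>A \<times> F. pscale (u (l, k')) (?c l * k'))" by (simp add: rel)
  also have "(\<Sum>(l, k')\<in>A \<times> F. pscale (u (l, k')) (?c l * k')) =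
      (\<Sum>(l, k')\<in>{m} \<times> F. pscale (u (l, k')) (?c l * k'))"
  proof (rule sum.mono_neutral_right)
    show "finite (A \<times> F)" using A F by (simp add: independent_mod_def)
    show "{m} \<times> F \<subseteq> A \<times> F" using less.prems by blast
    show "\<forall>p\<in>A \<times> F - {m} \<times> F. (case p of (l, k') \<Rightarrow> pscale (u (l, k')) (?c l * k')) = 0"
    proof
      fix p assume p: "p \<in> A \<times> F - {m} \<times> F"
      obtain l k' where "p = (l, k')" by (rule prod.exhaust)
      then show "(case p of (l, k') \<Rightarrow> pscale (u (l, k')) (?c l * k')) = 0"
        using p vanish[of l k'] by force
    qed
  qed
  also have "\<dots> = (\<Sum>k'\<in>F. pscale (u (m, k')) (?c m * k'))"
    by (simp add: sum.cartesian_product[symmetric])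
  also have "\<dots> = (\<Sum>k'\<in>F. pscale (c' * u (m, k')) k')"
    unfolding cm pscale_def[symmetric] by (simp add: mult.commute)
  finally have "(\<Sum>k'\<in>F. pscale (c' * u (m, k')) k') \<in> Im_C q"
    using mvp.subspace_neg[OF subspace_Im_C] by fastforce
  then have "c' * u (m, k) = 0"
    by (rule independent_modD[OF F]) (rule less.prems)
  then show ?case using \<open>c' \<noteq> 0\<close> by simp
qed

lemma card_independent_mod_Im_C_le:
  fixes q :: "('n::finite, 'k::field_char_0) mvpoly"
  assumes F: "independent_mod (Im_C q) F"
    and d: "\<And>i. Poly_Mapping.keys (partial_deriv i q) \<subseteq> box d"
  shows "card F \<le> (1 + d * CARD('n)) ^ CARD('n)"
proof -
  let ?n = "CARD('n)"
  have finF: "finite F" using F by (simp add: independent_mod_def)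
  obtain word :: "('n \<Rightarrow>\<^sub>0 nat) \<Rightarrow> 'n list"
    where word: "\<And>m i. count_list (word m) i = Poly_Mapping.lookup m i"
    using ex_word_of_exponent by metis
  have "finite (\<Union>f\<in>F. Poly_Mapping.keys f)" using finF by simp
  then obtain s where s: "(\<Union>f\<in>F. Poly_Mapping.keys f) \<subseteq> box s" using finite_subset_box by blast
  define S where "S = s + d * (?n * s)"
  let ?h = "\<lambda>(m, k). foldr (twisted_deriv q) (word m) k"
  have span: "?h p \<in> mvp.span ((\<lambda>m. Poly_Mapping.single m 1) ` box S)" if p: "p \<in> box s \<times> F"
    for p :: "('n \<Rightarrow>\<^sub>0 nat) \<times> ('n, 'k) mvpoly"
  proof -
    obtain m k where mk: "p = (m, k)" "m \<in> box s" "k \<in> F" using p by auto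
    have "length (word m) = (\<Sum>i\<in>UNIV. Poly_Mapping.lookup m i)"
      using sum_count_set[of "word m" UNIV] by (simp add: word)
    also have "\<dots> \<le> ?n * s"
      using mk(2) sum_bounded_above[of UNIV "Poly_Mapping.lookup m" s] by (simp add: box_def)
    finally have "s + d * length (word m) \<le> S" by (simp add: S_def)
    moreover have "Poly_Mapping.keys (?h p) \<subseteq> box (s + d * length (word m))"
      using keys_foldr_twisted_deriv_box[OF d, of k s] s mk by auto
    ultimately show ?thesis using box_mono by (intro keys_subset_box_imp_span) blast
  qed
  have "card ((box s :: ('n \<Rightarrow>\<^sub>0 nat) set) \<times> F) \<le>
      card ((\<lambda>m. Poly_Mapping.single m (1::'k)) ` (box S :: ('n \<Rightarrow>\<^sub>0 nat) set))"
  proof (rule card_independent_family_le[where h = ?h])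
    fix u and p :: "('n \<Rightarrow>\<^sub>0 nat) \<times> ('n, 'k) mvpoly"
    assume "(\<Sum>p\<in>box s \<times> F. pscale (u p) (?h p)) = 0" "p \<in> box s \<times> F"
    then show "u p = 0"
      using independent_mod_twisted_deriv[OF F finite_card_box(1) word]
      by (cases p) (auto simp: split_beta)
  qed (use finF span in \<open>auto simp: finite_card_box\<close>)
  also have "\<dots> \<le> card (box S :: ('n \<Rightarrow>\<^sub>0 nat) set)" by (intro card_image_le finite_card_box)
  finally have "(s + 1) ^ ?n * card F \<le> (S + 1) ^ ?n"
    by (simp add: card_cartesian_product finite_card_box)
  also have "S + 1 \<le> (s + 1) * (1 + d * ?n)" by (simp add: S_def algebra_simps)
  then have "(S + 1) ^ ?n \<le> (s + 1) ^ ?n * (1 + d * ?n) ^ ?n"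
    by (metis power_mono power_mult_distrib zero_le)
  finally show ?thesis by simp
qed

section \<open>Finite dimension of the quotient\<close>

text \<open>
  A basis of \<open>W\<close> is extended to a basis of the whole space; the added vectors are independent
  modulo \<open>W\<close>, so there are at most \<open>N\<close> of them.
\<close>

lemma finite_complement_of_independent_mod_bound:
  fixes W :: "('n, 'k::field) mvpoly set"
  assumes W: "mvp.subspace W" and bound: "\<And>F. independent_mod W F \<Longrightarrow> card F \<le> N"
  shows "\<exists>F. finite F \<and> mvp.span (W \<union> F) = UNIV"
proof -
  obtain B where B: "B \<subseteq> W" "mvp.independent B" "W \<subseteq> mvp.span B"
    by (rule mvp.maximal_independent_subset)
  let ?C = "mvp.extend_basis B"
  have BC: "B \<subseteq> ?C" by (rule mvp.extend_basis_superset[OF B(2)])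
  have "independent_mod W G" if G: "G \<subseteq> ?C - B" "finite G" for G
    unfolding independent_mod_def
  proof (intro conjI allI impI ballI)
    fix u k assume "(\<Sum>k\<in>G. pscale (u k) k) \<in> W" and k: "k \<in> G"
    then have "(\<Sum>k\<in>G. pscale (u k) k) \<in> mvp.span B" using B(3) by blast
    then obtain t r where t: "finite t" "t \<subseteq> B"
        "(\<Sum>k\<in>G. pscale (u k) k) = (\<Sum>b\<in>t. pscale (r b) b)"
      unfolding mvp.span_explicit by auto
    let ?v = "\<lambda>x. if x \<in> G then u x else - r x"
    have disj: "t \<inter> G = {}" using t(2) G(1) by blast
    have "(\<Sum>x\<in>G \<union> t. pscale (?v x) x) = (\<Sum>x\<in>G. pscale (?v x) x) + (\<Sum>x\<in>t. pscale (?v x) x)"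
      using disj G t by (intro sum.union_disjoint) auto
    also have "(\<Sum>x\<in>t. pscale (?v x) x) = (\<Sum>x\<in>t. - pscale (r x) x)"
      using disj by (intro sum.cong) auto
    finally have "(\<Sum>x\<in>G \<union> t. pscale (?v x) x) = 0" by (simp add: t(3) sum_negf)
    moreover have "G \<union> t \<subseteq> ?C" using G t BC by blast
    moreover have "finite (G \<union> t)" using G t by simp
    ultimately have "?v k = 0"
      using mvp.independentD[OF mvp.independent_extend_basis[OF B(2)], of "G \<union> t" ?v k] k by blast
    then show "u k = 0" using k by simp
  qed (use G in simp)
  then have "finite (?C - B)"
    using bound finite_if_finite_subsets_card_bdd[of "?C - B" N] by blast
  moreover have "mvp.span ?C \<subseteq> mvp.span (W \<union> (?C - B))"
    using B(1) by (intro mvp.span_mono) blast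
  then have "mvp.span (W \<union> (?C - B)) = UNIV"
    by (simp add: mvp.span_extend_basis[OF B(2)] top.extremum_unique)
  ultimately show ?thesis by blast
qed

lemma mvpoly_space_simps:
  "carrier mvpoly_space = UNIV" "\<zero>\<^bsub>mvpoly_space\<^esub> = 0" "x \<oplus>\<^bsub>mvpoly_space\<^esub> y = x + y"
  "c \<odot>\<^bsub>mvpoly_space\<^esub> x = pscale c x"
  by (simp_all add: mvpoly_space_def pscale_def)

lemma vectorspace_mvpoly_space:
  "vectorspace class_ring (mvpoly_space :: ('k::field, ('n, 'k) mvpoly) module)"
proof -
  have "abelian_group (mvpoly_space :: ('k, ('n, 'k) mvpoly) module)"
    by (rule abelian_groupI)
       (auto simp: mvpoly_space_simps add.assoc add.commute intro: exI[of _ "- x" for x])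
  then have "Module.module class_ring (mvpoly_space :: ('k, ('n, 'k) mvpoly) module)"
    by (rule moduleI[OF class_cring.is_cring])
       (auto simp: mvpoly_space_simps class_ring_simps mvp.scale_left_distrib mvp.scale_right_distrib)
  then show ?thesis by (rule vectorspace.intro[OF _ class_field])
qed

lemma subspace_mvpoly_space:
  fixes W :: "('n, 'k::field) mvpoly set"
  assumes "mvp.subspace W"
  shows "subspace class_ring W mvpoly_space"
proof (intro VectorSpace.subspace.intro submodule.intro vectorspace_mvpoly_space)
  show "Module.module class_ring (mvpoly_space :: ('k, ('n, 'k) mvpoly) module)"
    using vectorspace_mvpoly_space by (rule vectorspace.axioms(1))
qed (use assms in \<open>auto simp: mvpoly_space_simps mvp.subspace_0 mvp.subspace_add mvp.subspace_scale\<close>)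

lemma fin_dim_quotient_mvpoly_space:
  fixes W F :: "('n, 'k::field) mvpoly set"
  assumes W: "mvp.subspace W" and F: "finite F" "mvp.span (W \<union> F) = UNIV"
  shows "vectorspace.fin_dim class_ring (quotient_space mvpoly_space W)"
proof -
  let ?V = "mvpoly_space :: ('k, ('n, 'k) mvpoly) module"
  let ?Q = "quotient_space ?V W"
  let ?cl = "\<lambda>x. W +>\<^bsub>?V\<^esub> x"
  note sub = subspace_mvpoly_space[OF W]
  interpret Q: vectorspace class_ring ?Q by (rule vectorspace_quotient_space[OF sub])
  interpret W: abelian_subgroup W ?V by (rule subspace_imp_abelian_subgroup[OF sub])
  have carr: "carrier ?Q = range ?cl"
    by (auto simp: quotient_space_def A_RCOSETS_def' mvpoly_space_simps)
  have clF: "?cl ` F \<subseteq> carrier ?Q" by (auto simp: carr)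
  interpret S: submodule class_ring "Q.span (?cl ` F)" ?Q
    by (rule Q.span_is_submodule[OF clF])
  have clW: "?cl x = \<zero>\<^bsub>?Q\<^esub>" if "x \<in> W" for x
    using that by (simp add: quotient_space_def W.a_rcos_const)
  have "?cl x \<in> Q.span (?cl ` F)" for x
  proof -
    have "x \<in> mvp.span (W \<union> F)" by (simp add: F)
    then show ?thesis
    proof (induction rule: mvp.span_induct)
      case base
      have add: "?cl (x + y) = ?cl x \<oplus>\<^bsub>?Q\<^esub> ?cl y" for x y
        using W.a_rcos_sum[of x y] by (simp add: quotient_space_def mvpoly_space_simps)
      have smult: "?cl (pscale c x) = c \<odot>\<^bsub>?Q\<^esub> ?cl x" for c x
        using quotient_space_smult_coset[OF sub, of c x] by (simp add: mvpoly_space_simps)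
      show ?case
        by (rule mvp.subspaceI)
           (auto simp: add smult clW[OF mvp.subspace_0[OF W]])
    next
      case (step x)
      then show ?case using clW[of x] Q.in_own_span[OF clF] by auto
    qed
  qed
  then have "Q.span (?cl ` F) = carrier ?Q" using S.subset by (auto simp: carr)
  then show ?thesis unfolding Q.fin_dim_def using F clF by blast
qed

theorem corollary2p11:
  fixes q :: "('n::finite, 'k::field_char_0) mvpoly"
  shows "subspace class_ring (Im_C q) mvpoly_space \<and>
         vectorspace class_ring (quotient_space mvpoly_space (Im_C q)) \<and>
         vectorspace.fin_dim class_ring (quotient_space mvpoly_space (Im_C q))"
proof -
  have "finite (\<Union>i. Poly_Mapping.keys (partial_deriv i q))" by simp
  then obtain d where "(\<Union>i. Poly_Mapping.keys (partial_deriv i q)) \<subseteq> box d"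
    using finite_subset_box by blast
  then have d: "\<And>i. Poly_Mapping.keys (partial_deriv i q) \<subseteq> box d" by blast
  obtain F where "finite F" "mvp.span (Im_C q \<union> F) = UNIV"
    using finite_complement_of_independent_mod_bound[OF subspace_Im_C]
      card_independent_mod_Im_C_le[OF _ d] by blast
  then show ?thesis
    using subspace_Im_C
    by (blast intro: subspace_mvpoly_space vectorspace_quotient_space fin_dim_quotient_mvpoly_space)
qed

end
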